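(* For every $\varphi\in\mathcal{L}_{KB}$: $\mathsf{KB}_{=}\vdash\varphi$ if and only if $\varphi$ is true at every world of every mid-threshold epistemic neighborhood model.
   Context: Fix a set $\mathsf{Prop}$ of propositional letters. Language $\mathcal{L}_{KB}$: $\varphi::=\top\mid p\mid\neg\varphi\mid\varphi\wedge\varphi\mid K\varphi\mid B\varphi$ with Boolean abbreviations, $\check K:=\neg K\neg$, $\check B:=\neg B\neg$. Segerberg notation: $(\varphi_i\mathbb{I}\psi_i)_{i=1}^m$ is the formula $K(F_0\vee\cdots\vee F_m)$, where $F_i$ is the disjunction of all conjunctions $d_1\varphi_1\wedge\cdots\wedge d_m\varphi_m\wedge e_1\psi_1\wedge\cdots\wedge e_m\psi_m$ in which exactly $i$ of the $d_k$ are the empty string, at least $i$ of the $e_k$ are the empty string, and the remaining $d_k,e_k$ are $\neg$. Calculus $\mathsf{KB}_{=}$: axiom schemes (CL) classical tautologies; (KS5) the $\mathsf{S5}$ schemes for $K$; (BF) $\neg B\bot$; (N) $B\top$; (Ap) $B\varphi\to KB\varphi$; (An) $\neg B\varphi\to K\neg B\varphi$; (KBM) $K(\varphi\to\psi)\to(B\varphi\to B\psi)$; (D) $B\varphi\to\check B\varphi$; (SC) $\check B\varphi\wedge\check K(\neg\varphi\wedge\psi)\to B(\varphi\vee\psi)$; (Scott) $\big[(\varphi_i\mathbb{I}\psi_i)_{i=1}^m\wedge B\varphi_1\wedge\bigwedge_{i=2}^m\check B\varphi_i\big]\to\bigvee_{i=1}^m B\psi_i$ for all $m\in\mathbb{Z}^+$;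 rules modus ponens and from $\varphi$ infer $K\varphi$. An epistemic neighborhood model is $(W,R,V,N)$ with $W$ finite nonempty, $R$ an equivalence relation on $W$ (classes $[w]$), $V:W\to\wp(\mathsf{Prop})$, $N:W\to\wp(\wp(W))$ with, for all $w$: (kbc) $X\in N(w)\Rightarrow X\subseteq[w]$; (kbf) $\emptyset\notin N(w)$; (n) $[w]\in N(w)$; (a) $N(v)=N(w)$ for $v\in[w]$; (kbm) $X\subseteq Y\subseteq[w]$, $X\in N(w)$ imply $Y\in N(w)$. For sets $X_1,\dots,X_m,Y_1,\dots,Y_m$, $(X_i\mathbb{I}Y_i)_{i=1}^m$ means each $v\in W$ lies in at most as many $X_i$ as $Y_i$. It is mid-threshold if moreover for all $w$: (d) $X\in N(w)\Rightarrow[w]\setminus X\notin N(w)$; (sc) for $X,Y\subseteq[w]$, if $[w]\setminus X\notin N(w)$ and $X\subsetneq Y$ then $Y\in N(w)$; (scott) for all $m\in\mathbb{Z}^+$ and $X_1,\dots,X_m,Y_1,\dots,Y_m\subseteq[w]$, if $(X_i\mathbb{I}Y_i)_{i=1}^m$, $X_1\in N(w)$ and $[w]\setminus X_i\notin N(w)$ for $i=2,\dots,m$, then some $Y_j\in N(w)$. Truth: $p$ true at $w$ iff $p\in V(w)$; Boolean clauses standard; $K\varphi$ true at $w$ iff $[w]\subseteq[\![\varphi]\!]$; $B\varphi$ true at $w$ iff $[w]\cap[\![\varphi]\!]\in N(w)$, where $[\![\varphi]\!]$ is the set of worlds where $\varphi$ is true. *)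

theory Defs
  imports Main
begin

datatype 'p form =
    Top ("\<^bold>\<top>")
  | Letter 'p
  | Neg "'p form" ("\<^bold>\<not> _" [80] 80)
  | Conj "'p form" "'p form" (infixr "\<^bold>\<and>" 70)
  | Know "'p form" ("\<^bold>K _" [80] 80)
  | Bel "'p form" ("\<^bold>B _" [80] 80)

abbreviation Bot :: "'p form" ("\<^bold>\<bottom>") where
  "\<^bold>\<bottom> \<equiv> \<^bold>\<not> \<^bold>\<top>"

abbreviation Disj :: "'p form \<Rightarrow> 'p form \<Rightarrow> 'p form" (infixr "\<^bold>\<or>" 65) where
  "\<phi> \<^bold>\<or> \<psi> \<equiv> \<^bold>\<not> (\<^bold>\<not> \<phi> \<^bold>\<and> \<^bold>\<not> \<psi>)"

abbreviation Imp :: "'p form \<Rightarrow> 'p form \<Rightarrow> 'p form" (infixr "\<^bold>\<longrightarrow>" 60) where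
  "\<phi> \<^bold>\<longrightarrow> \<psi> \<equiv> \<^bold>\<not> (\<phi> \<^bold>\<and> \<^bold>\<not> \<psi>)"

abbreviation Know_dual :: "'p form \<Rightarrow> 'p form" ("\<^bold>K\<^sup>d _" [80] 80) where
  "\<^bold>K\<^sup>d \<phi> \<equiv> \<^bold>\<not> \<^bold>K \<^bold>\<not> \<phi>"

abbreviation Bel_dual :: "'p form \<Rightarrow> 'p form" ("\<^bold>B\<^sup>d _" [80] 80) where
  "\<^bold>B\<^sup>d \<phi> \<equiv> \<^bold>\<not> \<^bold>B \<^bold>\<not> \<phi>"

fun Conjs :: "'p form list \<Rightarrow> 'p form" where
  "Conjs [] = \<^bold>\<top>"
| "Conjs [\<phi>] = \<phi>"
| "Conjs (\<phi> # \<psi> # \<phi>s) = \<phi> \<^bold>\<and> Conjs (\<psi> # \<phi>s)"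

fun Disjs :: "'p form list \<Rightarrow> 'p form" where
  "Disjs [] = \<^bold>\<bottom>"
| "Disjs [\<phi>] = \<phi>"
| "Disjs (\<phi> # \<psi> # \<phi>s) = \<phi> \<^bold>\<or> Disjs (\<psi> # \<phi>s)"


text \<open>In a sign vector, \<^const>\<open>True\<close> stands for the empty string and \<^const>\<open>False\<close> for
  the string consisting of a negation sign.\<close>

definition signed :: "bool \<Rightarrow> 'p form \<Rightarrow> 'p form" where
  "signed s \<phi> = (if s then \<phi> else \<^bold>\<not> \<phi>)"

definition sign_vectors :: "nat \<Rightarrow> bool list list" where
  "sign_vectors m = List.n_lists m [True, False]"

definition segerberg_disjunct :: "'p form list \<Rightarrow> 'p form list \<Rightarrow> nat \<Rightarrow> 'p form" where
  "segerberg_disjunct \<phi>s \<psi>s i =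
    Disjs [Conjs (map2 signed d \<phi>s @ map2 signed e \<psi>s).
            d \<leftarrow> sign_vectors (length \<phi>s), e \<leftarrow> sign_vectors (length \<psi>s),
            count_list d True = i \<and> i \<le> count_list e True]"

definition segerberg :: "'p form list \<Rightarrow> 'p form list \<Rightarrow> 'p form" (infix "\<^bold>\<I>" 75) where
  "\<phi>s \<^bold>\<I> \<psi>s = \<^bold>K (Disjs (map (segerberg_disjunct \<phi>s \<psi>s) [0..<Suc (length \<phi>s)]))"


text \<open>Classical tautologies of the modal language are the formulas that hold under every
  assignment of truth values to the letters and to the formulas governed by a modal operator.\<close>

fun bool_eval :: "('p form \<Rightarrow> bool) \<Rightarrow> 'p form \<Rightarrow> bool" where
  "bool_eval t \<^bold>\<top> \<longleftrightarrow> True"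
| "bool_eval t (Letter p) \<longleftrightarrow> t (Letter p)"
| "bool_eval t (\<^bold>\<not> \<phi>) \<longleftrightarrow> \<not> bool_eval t \<phi>"
| "bool_eval t (\<phi> \<^bold>\<and> \<psi>) \<longleftrightarrow> bool_eval t \<phi> \<and> bool_eval t \<psi>"
| "bool_eval t (\<^bold>K \<phi>) \<longleftrightarrow> t (\<^bold>K \<phi>)"
| "bool_eval t (\<^bold>B \<phi>) \<longleftrightarrow> t (\<^bold>B \<phi>)"

definition tautology :: "'p form \<Rightarrow> bool" where
  "tautology \<phi> \<longleftrightarrow> (\<forall>t. bool_eval t \<phi>)"

text \<open>In \<open>Scott\<close>, and in the corresponding condition on models below, the sequences of length
  \<open>m \<ge> 1\<close> are lists whose first member is split off, since it is treated specially.\<close>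

inductive KB_eq :: "'p form \<Rightarrow> bool" ("\<turnstile>\<^sub>K\<^sub>B\<^sub>= _" [50] 50) where
  CL: "tautology \<phi> \<Longrightarrow> \<turnstile>\<^sub>K\<^sub>B\<^sub>= \<phi>"
| KS5_K: "\<turnstile>\<^sub>K\<^sub>B\<^sub>= \<^bold>K (\<phi> \<^bold>\<longrightarrow> \<psi>) \<^bold>\<longrightarrow> \<^bold>K \<phi> \<^bold>\<longrightarrow> \<^bold>K \<psi>"
| KS5_T: "\<turnstile>\<^sub>K\<^sub>B\<^sub>= \<^bold>K \<phi> \<^bold>\<longrightarrow> \<phi>"
| KS5_4: "\<turnstile>\<^sub>K\<^sub>B\<^sub>= \<^bold>K \<phi> \<^bold>\<longrightarrow> \<^bold>K \<^bold>K \<phi>"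
| KS5_5: "\<turnstile>\<^sub>K\<^sub>B\<^sub>= \<^bold>\<not> \<^bold>K \<phi> \<^bold>\<longrightarrow> \<^bold>K \<^bold>\<not> \<^bold>K \<phi>"
| BF: "\<turnstile>\<^sub>K\<^sub>B\<^sub>= \<^bold>\<not> \<^bold>B \<^bold>\<bottom>"
| N: "\<turnstile>\<^sub>K\<^sub>B\<^sub>= \<^bold>B \<^bold>\<top>"
| Ap: "\<turnstile>\<^sub>K\<^sub>B\<^sub>= \<^bold>B \<phi> \<^bold>\<longrightarrow> \<^bold>K \<^bold>B \<phi>"
| An: "\<turnstile>\<^sub>K\<^sub>B\<^sub>= \<^bold>\<not> \<^bold>B \<phi> \<^bold>\<longrightarrow> \<^bold>K \<^bold>\<not> \<^bold>B \<phi>"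
| KBM: "\<turnstile>\<^sub>K\<^sub>B\<^sub>= \<^bold>K (\<phi> \<^bold>\<longrightarrow> \<psi>) \<^bold>\<longrightarrow> \<^bold>B \<phi> \<^bold>\<longrightarrow> \<^bold>B \<psi>"
| D: "\<turnstile>\<^sub>K\<^sub>B\<^sub>= \<^bold>B \<phi> \<^bold>\<longrightarrow> \<^bold>B\<^sup>d \<phi>"
| SC: "\<turnstile>\<^sub>K\<^sub>B\<^sub>= \<^bold>B\<^sup>d \<phi> \<^bold>\<and> \<^bold>K\<^sup>d (\<^bold>\<not> \<phi> \<^bold>\<and> \<psi>) \<^bold>\<longrightarrow> \<^bold>B (\<phi> \<^bold>\<or> \<psi>)"
| Scott: "length (\<phi> # \<phi>s) = length \<psi>s \<Longrightarrow>
    \<turnstile>\<^sub>K\<^sub>B\<^sub>= ((\<phi> # \<phi>s) \<^bold>\<I> \<psi>s) \<^bold>\<and> \<^bold>B \<phi> \<^bold>\<and> Conjs (map Bel_dual \<phi>s) \<^bold>\<longrightarrow> Disjs (map Bel \<psi>s)"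
| MP: "\<turnstile>\<^sub>K\<^sub>B\<^sub>= \<phi> \<^bold>\<longrightarrow> \<psi> \<Longrightarrow> \<turnstile>\<^sub>K\<^sub>B\<^sub>= \<phi> \<Longrightarrow> \<turnstile>\<^sub>K\<^sub>B\<^sub>= \<psi>"
| Nec: "\<turnstile>\<^sub>K\<^sub>B\<^sub>= \<phi> \<Longrightarrow> \<turnstile>\<^sub>K\<^sub>B\<^sub>= \<^bold>K \<phi>"


text \<open>Worlds form a finite subset of a type, so up to isomorphism every model lives on any
  given infinite type of worlds.\<close>

record ('w, 'p) model =
  worlds :: "'w set"
  acc :: "('w \<times> 'w) set"
  val :: "'w \<Rightarrow> 'p set"
  nbhd :: "'w \<Rightarrow> 'w set set"

definition cell :: "('w, 'p) model \<Rightarrow> 'w \<Rightarrow> 'w set" where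
  "cell M w = acc M `` {w}"

definition epistemic_nbhd_model :: "('w, 'p) model \<Rightarrow> bool" where
  "epistemic_nbhd_model M \<longleftrightarrow>
    finite (worlds M) \<and> worlds M \<noteq> {} \<and> equiv (worlds M) (acc M) \<and>
    (\<forall>w \<in> worlds M.
      (\<forall>X \<in> nbhd M w. X \<subseteq> cell M w) \<and>
      {} \<notin> nbhd M w \<and>
      cell M w \<in> nbhd M w \<and>
      (\<forall>v \<in> cell M w. nbhd M v = nbhd M w) \<and>
      (\<forall>X Y. X \<subseteq> Y \<longrightarrow> Y \<subseteq> cell M w \<longrightarrow> X \<in> nbhd M w \<longrightarrow> Y \<in> nbhd M w))"

definition set_segerberg :: "'w set \<Rightarrow> 'w set list \<Rightarrow> 'w set list \<Rightarrow> bool" where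
  "set_segerberg W Xs Ys \<longleftrightarrow>
    (\<forall>v \<in> W. length (filter (\<lambda>X. v \<in> X) Xs) \<le> length (filter (\<lambda>Y. v \<in> Y) Ys))"

definition mid_threshold :: "('w, 'p) model \<Rightarrow> bool" where
  "mid_threshold M \<longleftrightarrow>
    epistemic_nbhd_model M \<and>
    (\<forall>w \<in> worlds M.
      (\<forall>X \<in> nbhd M w. cell M w - X \<notin> nbhd M w) \<and>
      (\<forall>X Y. X \<subseteq> cell M w \<longrightarrow> Y \<subseteq> cell M w \<longrightarrow>
        cell M w - X \<notin> nbhd M w \<longrightarrow> X \<subset> Y \<longrightarrow> Y \<in> nbhd M w) \<and>
      (\<forall>X Xs Ys. length (X # Xs) = length Ys \<longrightarrow>
        (\<forall>Z \<in> set (X # Xs) \<union> set Ys. Z \<subseteq> cell M w) \<longrightarrow>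
        set_segerberg (worlds M) (X # Xs) Ys \<longrightarrow>
        X \<in> nbhd M w \<longrightarrow> (\<forall>Z \<in> set Xs. cell M w - Z \<notin> nbhd M w) \<longrightarrow>
        (\<exists>Y \<in> set Ys. Y \<in> nbhd M w)))"

fun truth :: "('w, 'p) model \<Rightarrow> 'w \<Rightarrow> 'p form \<Rightarrow> bool" ("_, _ \<Turnstile> _" [50, 50, 50] 50) where
  "M, w \<Turnstile> \<^bold>\<top> \<longleftrightarrow> True"
| "M, w \<Turnstile> Letter p \<longleftrightarrow> p \<in> val M w"
| "M, w \<Turnstile> \<^bold>\<not> \<phi> \<longleftrightarrow> \<not> (M, w \<Turnstile> \<phi>)"
| "M, w \<Turnstile> \<phi> \<^bold>\<and> \<psi> \<longleftrightarrow> (M, w \<Turnstile> \<phi>) \<and> (M, w \<Turnstile> \<psi>)"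
| "M, w \<Turnstile> \<^bold>K \<phi> \<longleftrightarrow> cell M w \<subseteq> {v \<in> worlds M. M, v \<Turnstile> \<phi>}"
| "M, w \<Turnstile> \<^bold>B \<phi> \<longleftrightarrow> cell M w \<inter> {v \<in> worlds M. M, v \<Turnstile> \<phi>} \<in> nbhd M w"

end

(* Completeness by a one-cell canonical model: fix a maximal consistent set w containing the negation
   of an unprovable formula, take the maximal consistent sets that contain everything known in w, and
   identify those that agree on the subformulas. There are finitely many classes, so each set of
   classes is defined by a formula, and is declared a neighborhood if w believes that formula.
   As all sets of worlds are definable, each axiom scheme yields the corresponding frame condition. *)
theory Submission
  imports Defs
begin

section \<open>Boolean connectives\<close>

text \<open>The common abstraction of truth under an assignment, truth at a world and membership in
  a maximal consistent set. Facts about long conjunctions, disjunctions and Segerberg formulas are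
  proved once here and instantiated as required.\<close>

definition boolean_valuation :: "('p form \<Rightarrow> bool) \<Rightarrow> bool" where
  "boolean_valuation T \<longleftrightarrow> T Top \<and> (\<forall>\<phi>. T (Neg \<phi>) \<longleftrightarrow> \<not> T \<phi>) \<and>
     (\<forall>\<phi> \<psi>. T (Conj \<phi> \<psi>) \<longleftrightarrow> T \<phi> \<and> T \<psi>)"

lemma boolean_valuation_simps:
  assumes "boolean_valuation T"
  shows "T Top" "T (Neg \<phi>) \<longleftrightarrow> \<not> T \<phi>" "T (Conj \<phi> \<psi>) \<longleftrightarrow> T \<phi> \<and> T \<psi>"
  using assms by (auto simp: boolean_valuation_def)

lemma boolean_valuation_bool_eval: "boolean_valuation (bool_eval t)"
  by (simp add: boolean_valuation_def)

lemma boolean_valuation_truth: "boolean_valuation (truth M w)"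
  by (simp add: boolean_valuation_def)

text \<open>A Boolean valuation is determined by its values on letters and modal formulas. Taking
  \<open>T\<close> itself as the assignment shows that tautologies hold under
  \<open>T\<close>.\<close>

lemma boolean_valuation_eq_bool_eval:
  assumes "boolean_valuation T"
  shows "T \<phi> \<longleftrightarrow> bool_eval T \<phi>"
  by (induction \<phi>) (simp_all add: boolean_valuation_simps[OF assms])

lemma boolean_valuation_Conjs:
  assumes "boolean_valuation T"
  shows "T (Conjs \<phi>s) \<longleftrightarrow> (\<forall>\<phi> \<in> set \<phi>s. T \<phi>)"
  by (induction \<phi>s rule: Conjs.induct) (simp_all add: boolean_valuation_simps[OF assms])

lemmas bool_eval_Conjs = boolean_valuation_Conjs[OF boolean_valuation_bool_eval]

lemma boolean_valuation_Disjs: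
  assumes "boolean_valuation T"
  shows "T (Disjs \<phi>s) \<longleftrightarrow> (\<exists>\<phi> \<in> set \<phi>s. T \<phi>)"
  by (induction \<phi>s rule: Disjs.induct) (simp_all add: boolean_valuation_simps[OF assms])

section \<open>Segerberg formulas as counting conditions\<close>

lemma boolean_valuation_signed:
  assumes "boolean_valuation T"
  shows "T (signed s \<phi>) \<longleftrightarrow> (T \<phi> \<longleftrightarrow> s)"
  by (simp add: signed_def boolean_valuation_simps[OF assms])

text \<open>Like a state description, a list of signed formulas fixes every truth value, so at most
  one sign vector is realised.\<close>

lemma boolean_valuation_map2_signed:
  assumes "boolean_valuation T" "length d = length \<phi>s"
  shows "(\<forall>\<chi> \<in> set (map2 signed d \<phi>s). T \<chi>) \<longleftrightarrow> d = map T \<phi>s"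
  using assms(2)
  by (induction d \<phi>s rule: list_induct2) (auto simp: boolean_valuation_signed[OF assms(1)])

lemma count_list_map_True: "count_list (map T \<phi>s) True = length (filter T \<phi>s)"
  by (induction \<phi>s) auto

lemma boolean_valuation_segerberg_disjunct:
  assumes "boolean_valuation T"
  shows "T (segerberg_disjunct \<phi>s \<psi>s i) \<longleftrightarrow>
    length (filter T \<phi>s) = i \<and> i \<le> length (filter T \<psi>s)"
proof -
  have "T (segerberg_disjunct \<phi>s \<psi>s i) \<longleftrightarrow>
    (\<exists>d e. length d = length \<phi>s \<and> length e = length \<psi>s \<and>
       count_list d True = i \<and> i \<le> count_list e True \<and>
       (\<forall>\<chi> \<in> set (map2 signed d \<phi>s). T \<chi>) \<and> (\<forall>\<chi> \<in> set (map2 signed e \<psi>s). T \<chi>))"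
    unfolding segerberg_disjunct_def boolean_valuation_Disjs[OF assms] sign_vectors_def
    by (fastforce simp: set_n_lists boolean_valuation_Conjs[OF assms])
  \<comment> \<open>The only vectors that survive are \<open>map T \<phi>s\<close> and
    \<open>map T \<psi>s\<close>; their counts of \<open>True\<close> are the numbers of true
    formulas.\<close>
  also have "\<dots> \<longleftrightarrow> length (filter T \<phi>s) = i \<and> i \<le> length (filter T \<psi>s)"
    using boolean_valuation_map2_signed[OF assms]
    by (metis count_list_map_True length_map)
  finally show ?thesis .
qed

lemma boolean_valuation_segerberg_disjuncts:
  assumes "boolean_valuation T"
  shows "T (Disjs (map (segerberg_disjunct \<phi>s \<psi>s) [0..<Suc (length \<phi>s)])) \<longleftrightarrow>
    length (filter T \<phi>s) \<le> length (filter T \<psi>s)"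
  \<comment> \<open>The number of true members of \<open>\<phi>s\<close> is at most
    \<open>length \<phi>s\<close>, so the range of indices always includes it.\<close>
  by (auto simp: boolean_valuation_Disjs[OF assms] boolean_valuation_segerberg_disjunct[OF assms]
      less_Suc_eq_le simp del: upt_Suc)


section \<open>Soundness\<close>

lemma cell_eq:
  assumes "equiv (worlds M) (acc M)" "v \<in> cell M w"
  shows "cell M v = cell M w"
  using assms unfolding cell_def by (metis Image_singleton_iff equiv_class_eq)

lemma cell_subset:
  assumes "equiv (worlds M) (acc M)"
  shows "cell M w \<subseteq> worlds M"
  using assms unfolding cell_def by (auto simp: equiv_def refl_on_def)

lemma mem_cell_self:
  assumes "equiv (worlds M) (acc M)" "w \<in> worlds M"
  shows "w \<in> cell M w"
  using assms unfolding cell_def by (auto simp: equiv_def refl_on_def)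

text \<open>The frame condition is applied to extensions cut down to the cell. At worlds of the cell
  the Segerberg formula compares the counts; a world outside lies in none of these sets, so both
  counts are 0.\<close>

lemma Scott_sound:
  assumes M: "mid_threshold M" and w: "w \<in> worlds M" and len: "length (\<phi> # \<phi>s) = length \<psi>s"
    and seg: "M, w \<Turnstile> (\<phi> # \<phi>s) \<^bold>\<I> \<psi>s" and bel: "M, w \<Turnstile> Bel \<phi>"
    and dual: "\<forall>\<chi> \<in> set \<phi>s. M, w \<Turnstile> Bel_dual \<chi>"
  shows "\<exists>\<psi> \<in> set \<psi>s. M, w \<Turnstile> Bel \<psi>"
proof -
  have eq: "equiv (worlds M) (acc M)"
    using M by (simp add: mid_threshold_def epistemic_nbhd_model_def)
  define ext where "ext \<chi> = cell M w \<inter> {v \<in> worlds M. M, v \<Turnstile> \<chi>}" for \<chi>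
  have count: "length (filter (\<lambda>X. v \<in> X) (map ext \<chi>s)) = length (filter (truth M v) \<chi>s)"
    if "v \<in> cell M w" for v \<chi>s
    using that cell_subset[OF eq, of w] by (auto simp: filter_map o_def ext_def subset_iff)
  have empty: "filter (\<lambda>X. v \<in> X) (map ext \<chi>s) = []" if "v \<notin> cell M w" for v \<chi>s
    using that by (auto simp: filter_empty_conv ext_def)
  have "set_segerberg (worlds M) (map ext (\<phi> # \<phi>s)) (map ext \<psi>s)"
    unfolding set_segerberg_def
  proof
    fix v assume "v \<in> worlds M"
    show "length (filter (\<lambda>X. v \<in> X) (map ext (\<phi> # \<phi>s)))
      \<le> length (filter (\<lambda>X. v \<in> X) (map ext \<psi>s))"
    proof (cases "v \<in> cell M w")
      case True
      then have "M, v \<Turnstile> Disjs (map (segerberg_disjunct (\<phi> # \<phi>s) \<psi>s) [0..<Suc (length (\<phi> # \<phi>s))])"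
        using seg unfolding segerberg_def truth.simps by blast
      then show ?thesis
        unfolding boolean_valuation_segerberg_disjuncts[OF boolean_valuation_truth] count[OF True] .
    next
      case False
      then show ?thesis by (simp only: empty[OF False] order_refl)
    qed
  qed
  moreover have "ext \<phi> \<in> nbhd M w"
    using bel by (simp add: ext_def)
  moreover have "cell M w - Z \<notin> nbhd M w" if Z: "Z \<in> set (map ext \<phi>s)" for Z
  proof -
    obtain \<chi> where \<chi>: "\<chi> \<in> set \<phi>s" "Z = ext \<chi>"
      using Z by auto
    \<comment> \<open>Negation becomes complement relative to the cell, which turns dual belief into
      the hypothesis on complements in the frame condition.\<close>
    have "cell M w \<inter> {v \<in> worlds M. M, v \<Turnstile> Neg \<chi>} = cell M w - Z"
      using cell_subset[OF eq, of w] by (auto simp: \<chi>(2) ext_def)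
    then show ?thesis
      using dual \<chi>(1) by auto
  qed
  moreover have "\<forall>Z \<in> set (ext \<phi> # map ext \<phi>s) \<union> set (map ext \<psi>s). Z \<subseteq> cell M w"
    by (auto simp: ext_def)
  moreover have "length (ext \<phi> # map ext \<phi>s) = length (map ext \<psi>s)"
    using len by simp
  ultimately have "\<exists>Y \<in> set (map ext \<psi>s). Y \<in> nbhd M w"
    using bspec[OF conjunct2[OF M[unfolded mid_threshold_def]] w, THEN conjunct2, THEN conjunct2,
        THEN spec, THEN spec, THEN spec, of "ext \<phi>" "map ext \<phi>s" "map ext \<psi>s"]
    unfolding list.map by blast
  then show ?thesis
    by (auto simp: ext_def)
qed

text \<open>The world is generalised in the induction because \<open>Nec\<close> needs its premise
  at all worlds of the cell.\<close>

lemma soundness: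
  assumes "KB_eq \<phi>" "mid_threshold M" "w \<in> worlds M"
  shows "M, w \<Turnstile> \<phi>"
  using assms(1,3)
proof (induction arbitrary: w)
  case (CL \<phi>)
  then show ?case
    using boolean_valuation_eq_bool_eval[OF boolean_valuation_truth, of M w \<phi>]
    by (simp add: tautology_def)
next
  case (Scott \<phi> \<phi>s \<psi>s)
  show ?case
    using Scott_sound[OF assms(2) Scott(2,1)]
    by (auto simp: boolean_valuation_Conjs[OF boolean_valuation_truth]
        boolean_valuation_Disjs[OF boolean_valuation_truth] simp del: truth.simps(5,6))
next
  case (MP \<phi> \<psi>)
  then show ?case by auto
next
  case (Nec \<phi>)
  have "equiv (worlds M) (acc M)"
    using assms(2) by (simp add: mid_threshold_def epistemic_nbhd_model_def)
  then show ?case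
    using Nec cell_subset by fastforce
next
  case (SC \<phi> \<psi>)
  let ?X = "cell M w \<inter> {v \<in> worlds M. M, v \<Turnstile> \<phi>}"
  let ?Y = "cell M w \<inter> {v \<in> worlds M. M, v \<Turnstile> Disj \<phi> \<psi>}"
  have eq: "equiv (worlds M) (acc M)"
    using assms(2) by (simp add: mid_threshold_def epistemic_nbhd_model_def)
  have neg: "cell M w \<inter> {v \<in> worlds M. M, v \<Turnstile> Neg \<phi>} = cell M w - ?X"
    using cell_subset[OF eq, of w] by auto
  have "?Y \<in> nbhd M w" if b: "M, w \<Turnstile> Bel_dual \<phi>" and k: "M, w \<Turnstile> Know_dual (Conj (Neg \<phi>) \<psi>)"
  proof -
    have "cell M w - ?X \<notin> nbhd M w"
      using b by (simp only: truth.simps(3,6) neg[unfolded truth.simps]) simp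
    \<comment> \<open>The inclusion is proper because the \<open>Know_dual\<close> premise yields a
      world of the cell where \<psi> holds and \<phi> fails.\<close>
    moreover have "?X \<subset> ?Y"
      using k cell_subset[OF eq, of w] by auto
    ultimately show ?thesis
      using assms(2) SC unfolding mid_threshold_def by (meson inf_le1)
  qed
  then show ?case
    by (simp only: truth.simps) blast
next
  case (D \<phi>)
  let ?X = "cell M w \<inter> {v \<in> worlds M. M, v \<Turnstile> \<phi>}"
  have eq: "equiv (worlds M) (acc M)"
    using assms(2) by (simp add: mid_threshold_def epistemic_nbhd_model_def)
  have "cell M w \<inter> {v \<in> worlds M. \<not> (M, v \<Turnstile> \<phi>)} = cell M w - ?X"
    using cell_subset[OF eq, of w] by auto
  then show ?case
    using assms(2) D unfolding mid_threshold_def by auto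
next
  case (KBM \<phi> \<psi>)
  let ?X = "cell M w \<inter> {v \<in> worlds M. M, v \<Turnstile> \<phi>}"
  let ?Y = "cell M w \<inter> {v \<in> worlds M. M, v \<Turnstile> \<psi>}"
  have "?Y \<in> nbhd M w" if k: "M, w \<Turnstile> Know (Imp \<phi> \<psi>)" and b: "?X \<in> nbhd M w"
  proof -
    have "?X \<subseteq> ?Y" using k by auto
    moreover have "?Y \<subseteq> cell M w" by auto
    ultimately show ?thesis
      using assms(2) KBM b unfolding mid_threshold_def epistemic_nbhd_model_def by blast
  qed
  then show ?case
    by (simp only: truth.simps) blast
next
  case (KS5_K \<phi> \<psi>)
  then show ?case by auto
next
  case (KS5_T \<phi>)
  have "equiv (worlds M) (acc M)"
    using assms(2) by (simp add: mid_threshold_def epistemic_nbhd_model_def)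
  then show ?case
    using mem_cell_self KS5_T by fastforce
next
  case (KS5_4 \<phi>)
  have "equiv (worlds M) (acc M)"
    using assms(2) by (simp add: mid_threshold_def epistemic_nbhd_model_def)
  then show ?case
    using cell_eq[of M _ w] cell_subset[of M w] by (simp, blast)
next
  case (KS5_5 \<phi>)
  have "equiv (worlds M) (acc M)"
    using assms(2) by (simp add: mid_threshold_def epistemic_nbhd_model_def)
  then show ?case
    using cell_eq[of M _ w] cell_subset[of M w] by (simp, blast)
next
  case BF
  then show ?case
    using assms(2) by (simp add: mid_threshold_def epistemic_nbhd_model_def)
next
  case N
  have "equiv (worlds M) (acc M)" "cell M w \<in> nbhd M w"
    using assms(2) N by (simp_all add: mid_threshold_def epistemic_nbhd_model_def)
  then show ?case
    using cell_subset[of M w] by (simp add: Int_absorb2)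
next
  case (Ap \<phi>)
  have eq: "equiv (worlds M) (acc M)" and "\<forall>v \<in> cell M w. nbhd M v = nbhd M w"
    using assms(2) Ap by (simp_all add: mid_threshold_def epistemic_nbhd_model_def)
  \<comment> \<open>Both \<open>cell\<close> and \<open>nbhd\<close> are constant on a cell, hence
    so is belief.\<close>
  then have "M, v \<Turnstile> Bel \<phi> \<longleftrightarrow> M, w \<Turnstile> Bel \<phi>" if "v \<in> cell M w" for v
    using that cell_eq[OF eq that] by simp
  then show ?case
    using cell_subset[OF eq, of w] by (auto simp del: truth.simps(6))
next
  case (An \<phi>)
  have eq: "equiv (worlds M) (acc M)" and "\<forall>v \<in> cell M w. nbhd M v = nbhd M w"
    using assms(2) An by (simp_all add: mid_threshold_def epistemic_nbhd_model_def)
  then have "M, v \<Turnstile> Bel \<phi> \<longleftrightarrow> M, w \<Turnstile> Bel \<phi>" if "v \<in> cell M w" for v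
    using that cell_eq[OF eq that] by simp
  then show ?case
    using cell_subset[OF eq, of w] by (auto simp del: truth.simps(6))
qed


section \<open>Maximal consistent sets\<close>

text \<open>Premises are discharged one at a time by modus ponens until a tautology remains.
  Propositional derivations thus reduce to checks under all assignments.\<close>

lemma tautological_consequence:
  assumes "\<forall>\<psi> \<in> set \<psi>s. KB_eq \<psi>"
    and "\<And>t. \<forall>\<psi> \<in> set \<psi>s. bool_eval t \<psi> \<Longrightarrow> bool_eval t \<phi>"
  shows "KB_eq \<phi>"
  using assms
proof (induction \<psi>s arbitrary: \<phi>)
  case Nil
  then show ?case
    by (auto intro!: KB_eq.CL simp: tautology_def)
next
  case (Cons \<psi> \<psi>s)
  have "KB_eq (Imp \<psi> \<phi>)"
    using Cons.prems by (intro Cons.IH) auto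
  then show ?case
    using Cons.prems(1) KB_eq.MP by auto
qed

text \<open>Finite lists build compactness into the notion, which lets it pass to unions of
  chains.\<close>

definition consistent :: "'p form set \<Rightarrow> bool" where
  "consistent \<Gamma> \<longleftrightarrow> (\<forall>\<phi>s. set \<phi>s \<subseteq> \<Gamma> \<longrightarrow> \<not> KB_eq (Neg (Conjs \<phi>s)))"

text \<open>Maximality is expressed by deciding every formula; together with consistency this
  excludes proper consistent extensions.\<close>

definition max_consistent :: "'p form set \<Rightarrow> bool" where
  "max_consistent \<Gamma> \<longleftrightarrow> consistent \<Gamma> \<and> (\<forall>\<phi>. \<phi> \<in> \<Gamma> \<or> Neg \<phi> \<in> \<Gamma>)"

lemma consistent_insert_or_Neg:
  assumes "consistent \<Gamma>"
  shows "consistent (insert \<phi> \<Gamma>) \<or> consistent (insert (Neg \<phi>) \<Gamma>)"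
proof (rule ccontr)
  assume "\<not> ?thesis"
  then obtain xs ys where xs: "set xs \<subseteq> insert \<phi> \<Gamma>" "KB_eq (Neg (Conjs xs))"
    and ys: "set ys \<subseteq> insert (Neg \<phi>) \<Gamma>" "KB_eq (Neg (Conjs ys))"
    unfolding consistent_def by blast
  \<comment> \<open>The two refutations are merged after dropping \<phi> from one and
    \<open>Neg \<phi>\<close> from the other. Every assignment makes one of these two true, and the
    false formula of the corresponding list then survives in \<open>zs\<close>.\<close>
  define zs where "zs = filter (\<lambda>\<chi>. \<chi> \<noteq> \<phi>) xs @ filter (\<lambda>\<chi>. \<chi> \<noteq> Neg \<phi>) ys"
  have "KB_eq (Neg (Conjs zs))"
  proof (rule tautological_consequence[of "[Neg (Conjs xs), Neg (Conjs ys)]"])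
    show "\<forall>\<psi> \<in> set [Neg (Conjs xs), Neg (Conjs ys)]. KB_eq \<psi>"
      using xs(2) ys(2) by simp
    fix t :: "'a form \<Rightarrow> bool"
    assume "\<forall>\<psi> \<in> set [Neg (Conjs xs), Neg (Conjs ys)]. bool_eval t \<psi>"
    then obtain \<alpha> \<beta> where "\<alpha> \<in> set xs" "\<not> bool_eval t \<alpha>" "\<beta> \<in> set ys" "\<not> bool_eval t \<beta>"
      by (auto simp: bool_eval_Conjs)
    then have "\<exists>\<gamma> \<in> set zs. \<not> bool_eval t \<gamma>"
      by (cases "bool_eval t \<phi>") (force simp: zs_def)+
    then show "bool_eval t (Neg (Conjs zs))"
      by (simp add: bool_eval_Conjs)
  qed
  moreover have "set zs \<subseteq> \<Gamma>"
    using xs(1) ys(1) by (auto simp: zs_def)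
  ultimately show False
    using assms unfolding consistent_def by blast
qed

lemma consistent_Union_chain:
  assumes "subset.chain (Collect consistent) \<C>" "\<C> \<noteq> {}"
  shows "consistent (\<Union>\<C>)"
  unfolding consistent_def
proof (intro allI impI notI)
  fix \<phi>s assume sub: "set \<phi>s \<subseteq> \<Union>\<C>" and prov: "KB_eq (Neg (Conjs \<phi>s))"
  obtain \<Gamma> where "\<Gamma> \<in> \<C>" "set \<phi>s \<subseteq> \<Gamma>"
    using finite_subset_Union_chain[OF finite_set sub assms(2,1)] by blast
  then show False
    using prov assms(1) unfolding consistent_def subset.chain_def by blast
qed

text \<open>Zorn's lemma works for a language of any cardinality. A maximal consistent extension
  decides \<phi> because inserting \<phi> or inserting \<open>Neg \<phi>\<close> stays
  consistent.\<close>

lemma Lindenbaum: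
  assumes "consistent \<Gamma>"
  obtains \<Delta> where "max_consistent \<Delta>" "\<Gamma> \<subseteq> \<Delta>"
proof -
  have "\<exists>U \<in> {\<Delta>. consistent \<Delta> \<and> \<Gamma> \<subseteq> \<Delta>}. \<forall>X \<in> C. X \<subseteq> U"
    if C: "subset.chain {\<Delta>. consistent \<Delta> \<and> \<Gamma> \<subseteq> \<Delta>} C" for C
  proof (cases "C = {}")
    case True
    \<comment> \<open>The union of the empty chain need not contain \<Gamma>, so the bound here is
      \<Gamma> itself.\<close>
    then show ?thesis using assms by auto
  next
    case False
    have "subset.chain (Collect consistent) C"
      using C by (auto simp: subset.chain_def)
    then have "consistent (\<Union>C)"
      using False by (rule consistent_Union_chain)
    moreover have "\<Gamma> \<subseteq> \<Union>C"
      using C False unfolding subset.chain_def by blast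
    ultimately show ?thesis by blast
  qed
  from subset_Zorn[OF this] obtain \<Delta> where \<Delta>: "consistent \<Delta>" "\<Gamma> \<subseteq> \<Delta>"
    and max: "\<And>\<Theta>. consistent \<Theta> \<Longrightarrow> \<Gamma> \<subseteq> \<Theta> \<Longrightarrow> \<Delta> \<subseteq> \<Theta> \<Longrightarrow> \<Theta> = \<Delta>"
    by auto
  have "\<phi> \<in> \<Delta> \<or> Neg \<phi> \<in> \<Delta>" for \<phi>
    using consistent_insert_or_Neg[OF \<Delta>(1), of \<phi>] max \<Delta>(2)
    by (metis insertI1 subset_insertI subset_trans)
  then show ?thesis
    using that \<Delta> unfolding max_consistent_def by blast
qed

text \<open>Otherwise \<open>Neg \<psi>\<close> would be in \<open>w\<close>, and together with
  \<open>\<phi>s\<close> it would be refutable. The choice of \<open>Top\<close> for \<theta> gives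
  purely Boolean closure; other choices bring theorems into \<open>w\<close>.\<close>

lemma max_consistent_consequence:
  assumes w: "max_consistent w" and "set \<phi>s \<subseteq> w" "KB_eq \<theta>"
    and cons: "\<And>t. bool_eval t \<theta> \<Longrightarrow> \<forall>\<phi> \<in> set \<phi>s. bool_eval t \<phi> \<Longrightarrow> bool_eval t \<psi>"
  shows "\<psi> \<in> w"
proof (rule ccontr)
  assume "\<psi> \<notin> w"
  then have sub: "set (Neg \<psi> # \<phi>s) \<subseteq> w"
    using w assms(2) unfolding max_consistent_def by auto
  have "KB_eq (Neg (Conjs (Neg \<psi> # \<phi>s)))"
    by (rule tautological_consequence[of "[\<theta>]"])
      (use assms(3) cons in \<open>auto simp: bool_eval_Conjs\<close>)
  then show False
    using sub w unfolding max_consistent_def consistent_def by blast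
qed

lemma max_consistent_theorem:
  assumes "max_consistent w" "KB_eq \<phi>"
  shows "\<phi> \<in> w"
  using max_consistent_consequence[OF assms(1) _ assms(2), of "[]" \<phi>] by simp

lemma boolean_valuation_max_consistent:
  assumes w: "max_consistent w"
  shows "boolean_valuation (\<lambda>\<phi>. \<phi> \<in> w)"
proof -
  have top: "KB_eq Top"
    by (rule KB_eq.CL) (simp add: tautology_def)
  have neg: "Neg \<phi> \<in> w \<longleftrightarrow> \<phi> \<notin> w" for \<phi>
  proof -
    have "\<not> (\<phi> \<in> w \<and> Neg \<phi> \<in> w)"
    proof
      assume "\<phi> \<in> w \<and> Neg \<phi> \<in> w"
      moreover have "KB_eq (Neg (Conjs [\<phi>, Neg \<phi>]))"
        by (rule KB_eq.CL) (simp add: tautology_def)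
      ultimately show False
        using w unfolding max_consistent_def consistent_def
        by (metis empty_set empty_subsetI insert_subset list.simps(15))
    qed
    then show ?thesis
      using w unfolding max_consistent_def by blast
  qed
  have conj: "Conj \<phi> \<psi> \<in> w \<longleftrightarrow> \<phi> \<in> w \<and> \<psi> \<in> w" for \<phi> \<psi>
  proof
    assume "Conj \<phi> \<psi> \<in> w"
    then show "\<phi> \<in> w \<and> \<psi> \<in> w"
      using max_consistent_consequence[OF w _ top, of "[Conj \<phi> \<psi>]" \<phi>]
        max_consistent_consequence[OF w _ top, of "[Conj \<phi> \<psi>]" \<psi>]
      by simp
  next
    assume "\<phi> \<in> w \<and> \<psi> \<in> w"
    then show "Conj \<phi> \<psi> \<in> w"
      using max_consistent_consequence[OF w _ top, of "[\<phi>, \<psi>]" "Conj \<phi> \<psi>"]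
      by simp
  qed
  show ?thesis
    using neg conj max_consistent_theorem[OF w top] unfolding boolean_valuation_def by blast
qed

lemmas max_consistent_simps = boolean_valuation_simps[OF boolean_valuation_max_consistent]

lemma max_consistent_MP:
  assumes "max_consistent w" "KB_eq (Imp \<phi> \<psi>)" "\<phi> \<in> w"
  shows "\<psi> \<in> w"
  using max_consistent_theorem[OF assms(1,2)] assms(3)
  by (auto simp: max_consistent_simps[OF assms(1)])


section \<open>The canonical cell\<close>

text \<open>The successors of \<open>w\<close> under the canonical accessibility relation. For an S5
  modality this is the whole equivalence class of \<open>w\<close>, which is all that a countermodel
  at \<open>w\<close> requires.\<close>

definition canonical_cell :: "'p form set \<Rightarrow> 'p form set set" where
  "canonical_cell w = {v. max_consistent v \<and> (\<forall>\<phi>. Know \<phi> \<in> w \<longrightarrow> \<phi> \<in> v)}"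

lemma mem_canonical_cell_self:
  assumes "max_consistent w"
  shows "w \<in> canonical_cell w"
  using assms max_consistent_MP[OF assms KB_eq.KS5_T] by (auto simp: canonical_cell_def)

text \<open>Repeated distribution of \<open>Know\<close> over implication; the curried form avoids
  distributing it over conjunctions.\<close>

lemma Know_mem_foldr_Imp:
  assumes w: "max_consistent w" and "\<forall>\<phi> \<in> set \<phi>s. Know \<phi> \<in> w" "Know (foldr Imp \<phi>s \<psi>) \<in> w"
  shows "Know \<psi> \<in> w"
  using assms(2,3)
proof (induction \<phi>s)
  case (Cons \<phi> \<phi>s)
  have "Imp (Know \<phi>) (Know (foldr Imp \<phi>s \<psi>)) \<in> w"
    using max_consistent_MP[OF w KB_eq.KS5_K] Cons.prems(2) by simp
  then show ?case
    using Cons by (auto simp: max_consistent_simps[OF w])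
qed simp

lemma Know_mem_iff:
  assumes w: "max_consistent w"
  shows "Know \<phi> \<in> w \<longleftrightarrow> (\<forall>v \<in> canonical_cell w. \<phi> \<in> v)"
proof
  assume all: "\<forall>v \<in> canonical_cell w. \<phi> \<in> v"
  show "Know \<phi> \<in> w"
  proof (rule ccontr)
    assume notin: "Know \<phi> \<notin> w"
    \<comment> \<open>An inconsistency would make \<phi> derivable from finitely many known
      formulas; necessitation and distribution would then put \<open>Know \<phi>\<close> in
      \<open>w\<close>. Hence some member of the cell omits \<phi>.\<close>
    have "consistent (insert (Neg \<phi>) {\<psi>. Know \<psi> \<in> w})"
      unfolding consistent_def
    proof (intro allI impI notI)
      fix \<phi>s assume sub: "set \<phi>s \<subseteq> insert (Neg \<phi>) {\<psi>. Know \<psi> \<in> w}"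
        and prov: "KB_eq (Neg (Conjs \<phi>s))"
      define \<psi>s where "\<psi>s = filter (\<lambda>\<chi>. \<chi> \<noteq> Neg \<phi>) \<phi>s"
      have foldr: "bool_eval t (foldr Imp \<chi>s \<phi>) \<longleftrightarrow>
          ((\<forall>\<chi> \<in> set \<chi>s. bool_eval t \<chi>) \<longrightarrow> bool_eval t \<phi>)" for t \<chi>s
        by (induction \<chi>s) auto
      have "KB_eq (foldr Imp \<psi>s \<phi>)"
        by (rule tautological_consequence[of "[Neg (Conjs \<phi>s)]"])
          (use prov in \<open>auto simp: foldr bool_eval_Conjs \<psi>s_def\<close>)
      then have "Know (foldr Imp \<psi>s \<phi>) \<in> w"
        by (intro max_consistent_theorem[OF w] KB_eq.Nec)
      moreover have "\<forall>\<psi> \<in> set \<psi>s. Know \<psi> \<in> w"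
        using sub by (auto simp: \<psi>s_def)
      ultimately show False
        using Know_mem_foldr_Imp[OF w] notin by blast
    qed
    then obtain v where v: "max_consistent v" "insert (Neg \<phi>) {\<psi>. Know \<psi> \<in> w} \<subseteq> v"
      by (rule Lindenbaum)
    then have "v \<in> canonical_cell w" "\<phi> \<notin> v"
      by (auto simp: canonical_cell_def max_consistent_simps)
    then show False
      using all by blast
  qed
qed (auto simp: canonical_cell_def)

text \<open>By the introspection axioms, whichever of such a formula and its negation is in
  \<open>w\<close> is also known in \<open>w\<close>, hence belongs to \<open>v\<close>.\<close>

lemma modal_mem_canonical_cell:
  assumes w: "max_consistent w" and v: "v \<in> canonical_cell w"
  shows "Know \<phi> \<in> v \<longleftrightarrow> Know \<phi> \<in> w" "Bel \<phi> \<in> v \<longleftrightarrow> Bel \<phi> \<in> w"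
proof -
  have v': "max_consistent v" and sub: "Know \<chi> \<in> w \<Longrightarrow> \<chi> \<in> v" for \<chi>
    using v by (auto simp: canonical_cell_def)
  show "Know \<phi> \<in> v \<longleftrightarrow> Know \<phi> \<in> w"
    using sub max_consistent_MP[OF w KB_eq.KS5_4] max_consistent_MP[OF w KB_eq.KS5_5]
      max_consistent_simps(2)[OF w] max_consistent_simps(2)[OF v'] by blast
  show "Bel \<phi> \<in> v \<longleftrightarrow> Bel \<phi> \<in> w"
    using sub max_consistent_MP[OF w KB_eq.Ap] max_consistent_MP[OF w KB_eq.An]
      max_consistent_simps(2)[OF w] max_consistent_simps(2)[OF v'] by blast
qed

text \<open>Inclusion on the cell means that the implication is known, so \<open>KBM\<close>
  applies. Hence belief depends only on which members of the cell contain a formula.\<close>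

lemma Bel_mem_mono:
  assumes w: "max_consistent w" and sub: "\<And>v. v \<in> canonical_cell w \<Longrightarrow> \<phi> \<in> v \<Longrightarrow> \<psi> \<in> v"
    and "Bel \<phi> \<in> w"
  shows "Bel \<psi> \<in> w"
proof -
  have "Know (Imp \<phi> \<psi>) \<in> w"
    unfolding Know_mem_iff[OF w]
    using sub by (auto simp: canonical_cell_def max_consistent_simps)
  then have "Imp (Bel \<phi>) (Bel \<psi>) \<in> w"
    by (rule max_consistent_MP[OF w KB_eq.KBM])
  then show ?thesis
    using assms(3) by (auto simp: max_consistent_simps[OF w])
qed


section \<open>The finite canonical model\<close>

primrec subformulas :: "'p form \<Rightarrow> 'p form set" where
  "subformulas Top = {Top}"
| "subformulas (Letter p) = {Letter p}"
| "subformulas (Neg \<phi>) = insert (Neg \<phi>) (subformulas \<phi>)"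
| "subformulas (Conj \<phi> \<psi>) = insert (Conj \<phi> \<psi>) (subformulas \<phi> \<union> subformulas \<psi>)"
| "subformulas (Know \<phi>) = insert (Know \<phi>) (subformulas \<phi>)"
| "subformulas (Bel \<phi>) = insert (Bel \<phi>) (subformulas \<phi>)"

lemma finite_subformulas: "finite (subformulas \<phi>)"
  by (induction \<phi>) auto

text \<open>The map \<open>c\<close> names the classes of maximal consistent sets that agree on \<open>S\<close>, and \<open>\<chi> X\<close>
  is a formula defining the set \<open>X\<close> of classes.\<close>

locale filtration =
  fixes w :: "'p form set" and S :: "'p form set" and c :: "'p form set \<Rightarrow> 'w"
    and \<chi> :: "'w set \<Rightarrow> 'p form"
  assumes max_consistent: "max_consistent w"
    and finite_classes: "finite (c ` canonical_cell w)"
    and class_agree: "u \<in> canonical_cell w \<Longrightarrow> v \<in> canonical_cell w \<Longrightarrow> c u = c v \<Longrightarrow>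
      \<phi> \<in> S \<Longrightarrow> \<phi> \<in> u \<longleftrightarrow> \<phi> \<in> v"
    and definable: "v \<in> canonical_cell w \<Longrightarrow> \<chi> X \<in> v \<longleftrightarrow> c v \<in> X"
begin

abbreviation C where "C \<equiv> canonical_cell w"

abbreviation W where "W \<equiv> c ` C"

text \<open>There is a single cell, and neighborhoods are the same everywhere because belief is
  constant on it. The existential choice of a representative in \<open>val\<close> is immaterial for
  letters in \<open>S\<close>, on which each class agrees.\<close>

definition canonical_model :: "('w, 'p) model" where
  "canonical_model = \<lparr>worlds = W, acc = W \<times> W,
     val = (\<lambda>x. {p. \<exists>v \<in> C. c v = x \<and> Letter p \<in> v}),
     nbhd = (\<lambda>_. {X. X \<subseteq> W \<and> Bel (\<chi> X) \<in> w})\<rparr>"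

lemma cell_canonical_model: "x \<in> W \<Longrightarrow> cell canonical_model x = W"
  by (auto simp: canonical_model_def cell_def)

lemma max_consistent_C: "v \<in> C \<Longrightarrow> max_consistent v"
  by (simp add: canonical_cell_def)

lemmas mem_simps = max_consistent_simps[OF max_consistent_C] definable

lemma worlds_canonical_model: "worlds canonical_model = W"
  by (simp add: canonical_model_def)

text \<open>The chosen \<open>\<chi> X\<close> may be replaced by any formula that defines
  \<open>X\<close>, so the axioms can be applied to whatever formula they produce.\<close>

lemma mem_nbhd_iff:
  assumes "X \<subseteq> W" "\<And>v. v \<in> C \<Longrightarrow> \<phi> \<in> v \<longleftrightarrow> c v \<in> X"
  shows "X \<in> nbhd canonical_model x \<longleftrightarrow> Bel \<phi> \<in> w"
  using assms Bel_mem_mono[OF max_consistent, of \<phi> "\<chi> X"]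
    Bel_mem_mono[OF max_consistent, of "\<chi> X" \<phi>]
  by (auto simp: canonical_model_def definable)

lemma mem_nbhd_iff': "X \<subseteq> W \<Longrightarrow> X \<in> nbhd canonical_model x \<longleftrightarrow> Bel (\<chi> X) \<in> w"
  by (simp add: canonical_model_def)

lemma compl_mem_nbhd_iff:
  "X \<subseteq> W \<Longrightarrow> W - X \<in> nbhd canonical_model x \<longleftrightarrow> Bel (Neg (\<chi> X)) \<in> w"
  by (rule mem_nbhd_iff) (auto simp: mem_simps)

section \<open>The conditions on mid-threshold models\<close>

lemma epistemic_nbhd_model_canonical: "epistemic_nbhd_model canonical_model"
proof -
  have ne: "W \<noteq> {}"
    using mem_canonical_cell_self[OF max_consistent] by blast
  have equiv: "equiv W (acc canonical_model)"
    by (auto simp: canonical_model_def equiv_def refl_on_def sym_def trans_def)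
  \<comment> \<open>\<open>Neg Top\<close> defines the empty set and \<open>Top\<close> defines
    \<open>W\<close>, so \<open>BF\<close> and \<open>N\<close> apply directly.\<close>
  have kbf: "{} \<notin> nbhd canonical_model x" for x
    using mem_nbhd_iff[of "{}" "Neg Top" x] max_consistent_theorem[OF max_consistent KB_eq.BF]
    by (auto simp: mem_simps max_consistent_simps[OF max_consistent])
  have n: "W \<in> nbhd canonical_model x" for x
    using mem_nbhd_iff[of W Top x] max_consistent_theorem[OF max_consistent KB_eq.N]
    by (auto simp: mem_simps)
  have kbm: "Y \<in> nbhd canonical_model x"
    if XY: "X \<subseteq> Y" "Y \<subseteq> W" and X: "X \<in> nbhd canonical_model x" for X Y x
    using Bel_mem_mono[OF max_consistent, of "\<chi> X" "\<chi> Y"] XY X mem_nbhd_iff'[of X x]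
      mem_nbhd_iff'[of Y x] by (auto simp: definable)
  have kbc: "X \<in> nbhd canonical_model x \<Longrightarrow> X \<subseteq> W" for x X
    by (simp add: canonical_model_def)
  have a: "nbhd canonical_model y = nbhd canonical_model x" for x y
    by (simp add: canonical_model_def)
  show ?thesis
    unfolding epistemic_nbhd_model_def worlds_canonical_model
  proof (intro conjI ballI allI impI)
    fix x X Y
    assume "x \<in> W" "X \<subseteq> Y" "Y \<subseteq> cell canonical_model x" "X \<in> nbhd canonical_model x"
    then show "Y \<in> nbhd canonical_model x"
      using kbm[of X Y x] by (simp add: cell_canonical_model)
  qed (simp_all only: finite_classes ne equiv kbf n kbc cell_canonical_model a
      not_False_eq_True simp_thms)
qed

text \<open>Each set is replaced by its defining formula. Membership of \<open>\<chi> Z\<close> in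
  \<open>v\<close> mirrors membership of \<open>c v\<close> in \<open>Z\<close>, so the counts agree
  throughout the cell and the Segerberg formula is known.\<close>

lemma scott_canonical:
  assumes len: "length (X # Xs) = length Ys"
    and sub: "\<forall>Z \<in> set (X # Xs) \<union> set Ys. Z \<subseteq> W"
    and seg: "set_segerberg W (X # Xs) Ys"
    and X: "X \<in> nbhd canonical_model x"
    and Xs: "\<forall>Z \<in> set Xs. W - Z \<notin> nbhd canonical_model x"
  shows "\<exists>Y \<in> set Ys. Y \<in> nbhd canonical_model x"
proof -
  have "segerberg (map \<chi> (X # Xs)) (map \<chi> Ys) \<in> w"
    unfolding segerberg_def Know_mem_iff[OF max_consistent]
  proof
    fix v assume v: "v \<in> C"
    have count: "length (filter (\<lambda>\<phi>. \<phi> \<in> v) (map \<chi> Zs)) = length (filter (\<lambda>Z. c v \<in> Z) Zs)"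
      for Zs
      by (simp add: filter_map o_def definable[OF v])
    then show "Disjs (map (segerberg_disjunct (map \<chi> (X # Xs)) (map \<chi> Ys))
        [0..<Suc (length (map \<chi> (X # Xs)))]) \<in> v"
      unfolding boolean_valuation_segerberg_disjuncts[OF
          boolean_valuation_max_consistent[OF max_consistent_C[OF v]]] count
      using seg v unfolding set_segerberg_def by blast
  qed
  moreover have "Bel (\<chi> X) \<in> w"
    using X sub mem_nbhd_iff'[of X] by simp
  moreover have "Conjs (map Bel_dual (map \<chi> Xs)) \<in> w"
    using Xs sub
    by (auto simp: boolean_valuation_Conjs[OF boolean_valuation_max_consistent[OF max_consistent]]
        max_consistent_simps[OF max_consistent] compl_mem_nbhd_iff)
  ultimately have "Disjs (map Bel (map \<chi> Ys)) \<in> w"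
    using max_consistent_MP[OF max_consistent KB_eq.Scott[of "\<chi> X" "map \<chi> Xs" "map \<chi> Ys"]] len
    by (simp add: max_consistent_simps[OF max_consistent])
  then show ?thesis
    using sub mem_nbhd_iff'
    by (auto simp: boolean_valuation_Disjs[OF boolean_valuation_max_consistent[OF max_consistent]])
qed

lemma mid_threshold_canonical: "mid_threshold canonical_model"
proof -
  have d: "W - X \<notin> nbhd canonical_model x" if X: "X \<in> nbhd canonical_model x" for X x
  proof -
    have "X \<subseteq> W" "Bel (\<chi> X) \<in> w"
      using X by (auto simp: canonical_model_def)
    then show ?thesis
      using max_consistent_MP[OF max_consistent KB_eq.D, of "\<chi> X"]
      by (simp add: compl_mem_nbhd_iff max_consistent_simps[OF max_consistent])
  qed
  have sc: "Y \<in> nbhd canonical_model x"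
    if sub: "X \<subseteq> W" "Y \<subseteq> W" and compl: "W - X \<notin> nbhd canonical_model x" and lt: "X \<subset> Y"
    for X Y x
  proof -
    \<comment> \<open>A class in \<open>Y - X\<close> has a representative containing
      \<open>Neg (\<chi> X)\<close> and \<open>\<chi> Y\<close>, which witnesses the dual-knowledge
      premise of \<open>SC\<close>.\<close>
    obtain v where "v \<in> C" "c v \<in> Y - X"
      using lt sub by blast
    then have "Know (Neg (Conj (Neg (\<chi> X)) (\<chi> Y))) \<notin> w"
      by (auto simp: Know_mem_iff[OF max_consistent] mem_simps)
    moreover have "Bel (Neg (\<chi> X)) \<notin> w"
      using compl compl_mem_nbhd_iff[OF sub(1)] by simp
    ultimately have "Bel (Disj (\<chi> X) (\<chi> Y)) \<in> w"
      using max_consistent_MP[OF max_consistent KB_eq.SC, of "\<chi> X" "\<chi> Y"]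
      by (simp add: max_consistent_simps[OF max_consistent])
    \<comment> \<open>Since \<open>X \<subset> Y\<close>, the disjunction supplied by
      \<open>SC\<close> defines \<open>Y\<close> itself.\<close>
    then show ?thesis
      using mem_nbhd_iff[OF sub(2), of "Disj (\<chi> X) (\<chi> Y)"] lt by (auto simp: mem_simps)
  qed
  have cells: "\<And>x. x \<in> worlds canonical_model \<Longrightarrow> cell canonical_model x = W"
    by (simp add: worlds_canonical_model cell_canonical_model)
  show ?thesis
    unfolding mid_threshold_def
  proof (intro conjI ballI allI impI)
    fix x X Xs Ys
    assume "x \<in> worlds canonical_model" "length (X # Xs) = length Ys"
      "\<forall>Z \<in> set (X # Xs) \<union> set Ys. Z \<subseteq> cell canonical_model x"
      "set_segerberg (worlds canonical_model) (X # Xs) Ys" "X \<in> nbhd canonical_model x"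
      "\<forall>Z \<in> set Xs. cell canonical_model x - Z \<notin> nbhd canonical_model x"
    then show "\<exists>Y \<in> set Ys. Y \<in> nbhd canonical_model x"
      using scott_canonical[of X Xs Ys x] by (simp only: cells worlds_canonical_model)
  next
    fix x X Y
    assume "x \<in> worlds canonical_model" "X \<subseteq> cell canonical_model x" "Y \<subseteq> cell canonical_model x"
      "cell canonical_model x - X \<notin> nbhd canonical_model x" "X \<subset> Y"
    then show "Y \<in> nbhd canonical_model x"
      using sc[of X Y x] by (simp add: cells)
  next
    fix x X
    assume "x \<in> worlds canonical_model" "X \<in> nbhd canonical_model x"
    then show "cell canonical_model x - X \<notin> nbhd canonical_model x"
      using d[of X x] by (simp add: cells)
  qed (rule epistemic_nbhd_model_canonical)
qed

section \<open>Truth lemma\<close>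

lemma truth_canonical:
  assumes "subformulas \<phi> \<subseteq> S" "v \<in> C"
  shows "canonical_model, c v \<Turnstile> \<phi> \<longleftrightarrow> \<phi> \<in> v"
  using assms
proof (induction \<phi> arbitrary: v)
  case (Letter p)
  \<comment> \<open>All representatives agree on the letter, since it lies in
    \<open>S\<close>.\<close>
  then have "(\<exists>u \<in> C. c u = c v \<and> Letter p \<in> u) \<longleftrightarrow> Letter p \<in> v"
    using class_agree by (metis insert_subset subformulas.simps(2))
  then show ?case
    by (simp add: canonical_model_def)
next
  case (Know \<phi>)
  then have "canonical_model, c v \<Turnstile> Know \<phi> \<longleftrightarrow> (\<forall>u \<in> C. \<phi> \<in> u)"
    by (auto simp: cell_canonical_model worlds_canonical_model)
  then show ?case
    using Know.prems(2) modal_mem_canonical_cell[OF max_consistent] Know_mem_iff[OF max_consistent]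
    by blast
next
  case (Bel \<phi>)
  \<comment> \<open>By induction \<phi> itself defines its extension, so \<open>mem_nbhd_iff\<close>
    applies even if \<chi> chose another formula.\<close>
  have "{x \<in> W. canonical_model, x \<Turnstile> \<phi>} \<in> nbhd canonical_model (c v) \<longleftrightarrow> Bel \<phi> \<in> w"
    using Bel by (intro mem_nbhd_iff) auto
  moreover have "W \<inter> {x \<in> W. canonical_model, x \<Turnstile> \<phi>} = {x \<in> W. canonical_model, x \<Turnstile> \<phi>}"
    by auto
  ultimately show ?case
    using Bel.prems(2) modal_mem_canonical_cell[OF max_consistent]
    by (simp add: cell_canonical_model worlds_canonical_model)
qed (auto simp: mem_simps)

end

section \<open>Existence of a filtration, and completeness\<close>

lemma filtration_exists:
  fixes w S :: "'p form set"
  assumes "infinite (UNIV :: 'w set)" and w: "max_consistent w" and S: "finite S"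
  obtains c :: "'p form set \<Rightarrow> 'w" and \<chi> where "filtration w S c \<chi>"
proof -
  let ?C = "canonical_cell w"
  \<comment> \<open>An infinite type has room for a distinct name for every possible trace
    \<open>v \<inter> S\<close>.\<close>
  obtain B :: "'w set" where B: "finite B" "card B = card (Pow S)"
    using infinite_arbitrarily_large[OF assms(1)] by blast
  then obtain g where g: "bij_betw g (Pow S) B"
    using S finite_same_card_bij[of "Pow S" B] by auto
  define c where "c v = g (v \<inter> S)" for v
  have c_eq: "c u = c v \<longleftrightarrow> u \<inter> S = v \<inter> S" for u v
    using bij_betw_imp_inj_on[OF g] by (auto simp: c_def inj_on_def)
  have "range c \<subseteq> B"
    using bij_betw_imp_surj_on[OF g] by (auto simp: c_def)
  then have fin: "finite (c ` X)" for X
    using B(1) by (meson finite_subset image_mono subset_UNIV)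
  obtain fs where fs: "set fs = S"
    using finite_list[OF S] by blast
  have single: "\<exists>\<phi>. \<forall>v \<in> ?C. \<phi> \<in> v \<longleftrightarrow> c v = x" if x: "x \<in> c ` ?C" for x
  proof -
    obtain u where u: "u \<in> ?C" "x = c u"
      using x by blast
    \<comment> \<open>The state description of \<open>u\<close> over \<open>S\<close> defines the
      class of \<open>u\<close>.\<close>
    have "Conjs (map (\<lambda>\<psi>. signed (\<psi> \<in> u) \<psi>) fs) \<in> v \<longleftrightarrow> c v = x" if v: "v \<in> ?C" for v
    proof -
      have T: "boolean_valuation (\<lambda>\<phi>. \<phi> \<in> v)"
        using v by (simp add: canonical_cell_def boolean_valuation_max_consistent)
      show ?thesis
        by (auto simp: boolean_valuation_Conjs[OF T] boolean_valuation_signed[OF T] u(2) c_eq fs)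
    qed
    then show ?thesis by blast
  qed
  have "\<exists>\<phi>. \<forall>v \<in> ?C. \<phi> \<in> v \<longleftrightarrow> c v \<in> X" for X
  proof -
    obtain f where f: "\<And>x v. x \<in> c ` ?C \<Longrightarrow> v \<in> ?C \<Longrightarrow> f x \<in> v \<longleftrightarrow> c v = x"
      using single by metis
    obtain xs where xs: "set xs = X \<inter> c ` ?C"
      using finite_list[of "X \<inter> c ` ?C"] fin by blast
    \<comment> \<open>As there are finitely many classes, a disjunction of their defining formulas
      handles arbitrary \<open>X\<close>.\<close>
    have "Disjs (map f xs) \<in> v \<longleftrightarrow> c v \<in> X" if v: "v \<in> ?C" for v
    proof -
      have T: "boolean_valuation (\<lambda>\<phi>. \<phi> \<in> v)"
        using v by (simp add: canonical_cell_def boolean_valuation_max_consistent)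
      show ?thesis
        using f v by (auto simp: boolean_valuation_Disjs[OF T] xs)
    qed
    then show ?thesis by blast
  qed
  then obtain \<chi> where "\<And>X v. v \<in> ?C \<Longrightarrow> \<chi> X \<in> v \<longleftrightarrow> c v \<in> X"
    by metis
  then have "filtration w S c \<chi>"
    using w fin c_eq by unfold_locales blast+
  then show ?thesis
    by (rule that)
qed

lemma completeness:
  fixes \<phi> :: "'p form"
  assumes inf: "infinite (UNIV :: 'w set)"
    and valid: "\<forall>M :: ('w, 'p) model. mid_threshold M \<longrightarrow> (\<forall>w \<in> worlds M. M, w \<Turnstile> \<phi>)"
  shows "KB_eq \<phi>"
proof (rule ccontr)
  assume unprovable: "\<not> KB_eq \<phi>"
  \<comment> \<open>A refutable list of copies of \<open>Neg \<phi>\<close>, possibly empty, would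
    already prove \<phi>.\<close>
  have "consistent {Neg \<phi>}"
    unfolding consistent_def
  proof (intro allI impI notI)
    fix \<psi>s assume "set \<psi>s \<subseteq> {Neg \<phi>}" "KB_eq (Neg (Conjs \<psi>s))"
    then have "KB_eq \<phi>"
      by (intro tautological_consequence[of "[Neg (Conjs \<psi>s)]"])
        (auto simp: bool_eval_Conjs)
    then show False
      using unprovable by blast
  qed
  then obtain w where w: "max_consistent w" "Neg \<phi> \<in> w"
    by (rule Lindenbaum) blast
  obtain c :: "'p form set \<Rightarrow> 'w" and \<chi> where "filtration w (subformulas \<phi>) c \<chi>"
    using filtration_exists[OF inf w(1) finite_subformulas] .
  then interpret filtration w "subformulas \<phi>" c \<chi> .
  have self: "w \<in> C"
    by (rule mem_canonical_cell_self[OF w(1)])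
  have "canonical_model, c w \<Turnstile> \<phi>"
    using valid mid_threshold_canonical self by (auto simp: worlds_canonical_model)
  then show False
    using truth_canonical[OF subset_refl self] w by (simp add: max_consistent_simps)
qed

text \<open>Quantification over types is not expressible in a formula. The equivalence therefore
  fixes one infinite type of worlds, and the second conjunct extends soundness to the arbitrary type
  \<open>'v\<close>.\<close>

theorem mainTheorem11:
  fixes \<phi> :: "'p form"
  assumes "infinite (UNIV :: 'w set)"
  shows "(\<turnstile>\<^sub>K\<^sub>B\<^sub>= \<phi> \<longleftrightarrow>
            (\<forall>M :: ('w, 'p) model. mid_threshold M \<longrightarrow> (\<forall>w \<in> worlds M. M, w \<Turnstile> \<phi>))) \<and>
         (\<turnstile>\<^sub>K\<^sub>B\<^sub>= \<phi> \<longrightarrow>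
            (\<forall>M :: ('v, 'p) model. mid_threshold M \<longrightarrow> (\<forall>w \<in> worlds M. M, w \<Turnstile> \<phi>)))"
proof (intro conjI iffI impI allI ballI)
  assume "\<forall>M :: ('w, 'p) model. mid_threshold M \<longrightarrow> (\<forall>w \<in> worlds M. M, w \<Turnstile> \<phi>)"
  then show "KB_eq \<phi>"
    by (rule completeness[OF assms])
qed (rule soundness; assumption)+

end
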